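(* Let $\mathcal{L}$ be a propositional language. The $\boldsymbol{\Sigma}_{\mathcal{L}}$-module $\mathbf{Mult}_{\mathcal{L}}$ is cyclic and onto-projective in the category of $\boldsymbol{\Sigma}_{\mathcal{L}}$-modules; in particular it has the representation property (REP).
   Context: $\mathbf{Fm}_{\mathcal{L}}$ is the algebra of $\mathcal{L}$-formulas over countably many variables; substitutions are its endomorphisms. For a set $X$, $X^\flat$ is the set of finite multisets over $X$ (functions $X\to\mathbb{N}$ with finite support), ordered by $\mathfrak{X}\leqslant\mathfrak{Y}$ iff $\mathfrak{X}(x)\leq\mathfrak{Y}(x)$ for all $x$, with multiset sum $\uplus$ (pointwise addition) and empty multiset $\emptyset$; maps $f$ extend to multisets by $f([a_1,\dots,a_n])=[f(a_1),\dots,f(a_n)]$. $\boldsymbol{\Sigma}_{\mathcal{L}}=\langle\mathrm{End}(\mathbf{Fm}_{\mathcal{L}})^\flat,\leqslant,\uplus,\cdot,\emptyset,[\mathrm{id}]\rangle$ where $[\sigma_1,\dots,\sigma_n]\cdot[\pi_1,\dots,\pi_m]=[\sigma_i\circ\pi_j: i\leq n, j\leq m]$ (a dually integral po-semiring). $\mathbf{Mult}_{\mathcal{L}}=\langle Fm_{\mathcal{L}}^\flat,\leqslant,\uplus,\emptyset,\ast\rangle$ with $[\sigma_1,\dots,\sigma_n]\ast\Gamma=\sigma_1(\Gamma)\uplus\dots\uplus\sigma_n(\Gamma)$. For a dually integral po-semiring $\mathbf{A}$ (structure $\langle A,\leq,+,\cdot,0,1\rangle$: $\langle A,\cdot,1\rangle$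 monoid, $\langle A,\leq,+,0\rangle$ commutative pomonoid with $0$ least, $0$ absorbing for $\cdot$, $\cdot$ distributing over $+$, $\cdot$ monotone in each argument by elements $\geq 0$), an $\mathbf{A}$-module is $\langle R,\leq,+,0,\ast\rangle$ with $\langle R,\leq,+,0\rangle$ a commutative pomonoid with least element $0$ and $\ast\colon A\times R\to R$ a monoid action with $0\ast a=0$, distributive over $+$ in both arguments, and monotone in each coordinate. Morphisms are order-preserving monoid homomorphisms commuting with $\ast$. A module $\boldsymbol{R}$ is cyclic if $R=\{\sigma\ast a:\sigma\in A\}$ for some $a\in R$; onto-projective if for all morphisms $f\colon\boldsymbol{S}\to\boldsymbol{T}$ surjective and $g\colon\boldsymbol{R}\to\boldsymbol{T}$ there is a morphism $h$ with $f\circ h=g$. A deductive operator (DO) on $\langle R,\leq,+,0\rangle$ is $\delta\colon R\to\wp(R)$ with $a\in\delta(a)$; $a\leq b\Rightarrow\delta(a)\subseteq\delta(b)$; $a\in\delta(b)\Rightarrow\delta(a)\subseteq\delta(b)$; $a\in\delta(b)\Rightarrow a+c\in\delta(b+c)$; it is action-invariant if $a\in\delta(b)\Rightarrow\sigma\ast a\in\delta(\sigma\ast b)$. $\boldsymbol{R}_\delta$ is the module with universe $\{\delta(a):a\in R\}$, order $\subseteq$, $\delta(a)+\delta(b)=\delta(a+b)$, zero $\delta(0)$, $\sigma\ast\delta(a)=\delta(\sigma\ast a)$. $\boldsymbol{R}$ has the REP if for every module $\boldsymbol{S}$, action-invariant DOs $\delta$ on $\boldsymbol{R}$, $\gamma$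 on $\boldsymbol{S}$, and every injective order-reflecting morphism $\Phi\colon\boldsymbol{R}_\delta\to\boldsymbol{S}_\gamma$, there is a morphism $\tau\colon\boldsymbol{R}\to\boldsymbol{S}$ with $\gamma\circ\tau=\Phi\circ\delta$. *)

theory Defs
  imports "HOL-Algebra.Ring" "HOL-Library.Multiset"
begin

section \<open>Partially ordered semirings and their modules\<close>

text \<open>
  As for the modules of HOL-Algebra, additive structures are presented on the ring record, so
  that \<open>abelian_monoid\<close> and \<open>semiring\<close> apply.  For modules, the multiplicative fields
  \<open>mult\<close> and \<open>one\<close> of the record are unused: no definition below refers to them.
\<close>

record 'a po_ring = "'a ring" +
  leq :: "'a \<Rightarrow> 'a \<Rightarrow> bool" (infix \<open>\<preceq>\<index>\<close> 50)

record ('a, 'r) po_module = "'r po_ring" +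
  act :: "'a \<Rightarrow> 'r \<Rightarrow> 'r" (infixr \<open>\<star>\<index>\<close> 75)

locale comm_pomonoid = abelian_monoid R for R (structure) +
  assumes leq_refl: "a \<in> carrier R \<Longrightarrow> a \<preceq> a"
    and leq_trans: "\<lbrakk>a \<in> carrier R; b \<in> carrier R; c \<in> carrier R; a \<preceq> b; b \<preceq> c\<rbrakk> \<Longrightarrow> a \<preceq> c"
    and leq_antisym: "\<lbrakk>a \<in> carrier R; b \<in> carrier R; a \<preceq> b; b \<preceq> a\<rbrakk> \<Longrightarrow> a = b"
    and add_mono: "\<lbrakk>a \<in> carrier R; b \<in> carrier R; c \<in> carrier R; a \<preceq> b\<rbrakk> \<Longrightarrow> a \<oplus> c \<preceq> b \<oplus> c"
    and zero_least: "a \<in> carrier R \<Longrightarrow> \<zero> \<preceq> a"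

locale dually_integral_po_semiring = comm_pomonoid A + semiring A for A (structure) +
  assumes mult_mono_left:
      "\<lbrakk>a \<in> carrier A; b \<in> carrier A; c \<in> carrier A; a \<preceq> b; \<zero> \<preceq> c\<rbrakk> \<Longrightarrow> a \<otimes> c \<preceq> b \<otimes> c"
    and mult_mono_right:
      "\<lbrakk>a \<in> carrier A; b \<in> carrier A; c \<in> carrier A; a \<preceq> b; \<zero> \<preceq> c\<rbrakk> \<Longrightarrow> c \<otimes> a \<preceq> c \<otimes> b"

locale po_module = A?: dually_integral_po_semiring A + R?: comm_pomonoid R
  for A :: "'a po_ring" (structure) and R :: "('a, 'r) po_module" (structure) +
  assumes act_closed: "\<lbrakk>\<sigma> \<in> carrier A; a \<in> carrier R\<rbrakk> \<Longrightarrow> \<sigma> \<star>\<^bsub>R\<^esub> a \<in> carrier R"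
    and act_one: "a \<in> carrier R \<Longrightarrow> \<one>\<^bsub>A\<^esub> \<star>\<^bsub>R\<^esub> a = a"
    and act_mult: "\<lbrakk>\<sigma> \<in> carrier A; \<pi> \<in> carrier A; a \<in> carrier R\<rbrakk> \<Longrightarrow>
      (\<sigma> \<otimes>\<^bsub>A\<^esub> \<pi>) \<star>\<^bsub>R\<^esub> a = \<sigma> \<star>\<^bsub>R\<^esub> (\<pi> \<star>\<^bsub>R\<^esub> a)"
    and act_zero: "a \<in> carrier R \<Longrightarrow> \<zero>\<^bsub>A\<^esub> \<star>\<^bsub>R\<^esub> a = \<zero>\<^bsub>R\<^esub>"
    and act_add_left: "\<lbrakk>\<sigma> \<in> carrier A; \<pi> \<in> carrier A; a \<in> carrier R\<rbrakk> \<Longrightarrow>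
      (\<sigma> \<oplus>\<^bsub>A\<^esub> \<pi>) \<star>\<^bsub>R\<^esub> a = (\<sigma> \<star>\<^bsub>R\<^esub> a) \<oplus>\<^bsub>R\<^esub> (\<pi> \<star>\<^bsub>R\<^esub> a)"
    and act_add_right: "\<lbrakk>\<sigma> \<in> carrier A; a \<in> carrier R; b \<in> carrier R\<rbrakk> \<Longrightarrow>
      \<sigma> \<star>\<^bsub>R\<^esub> (a \<oplus>\<^bsub>R\<^esub> b) = (\<sigma> \<star>\<^bsub>R\<^esub> a) \<oplus>\<^bsub>R\<^esub> (\<sigma> \<star>\<^bsub>R\<^esub> b)"
    and act_mono_left: "\<lbrakk>\<sigma> \<in> carrier A; \<pi> \<in> carrier A; a \<in> carrier R; \<sigma> \<preceq>\<^bsub>A\<^esub> \<pi>\<rbrakk> \<Longrightarrow>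
      \<sigma> \<star>\<^bsub>R\<^esub> a \<preceq>\<^bsub>R\<^esub> \<pi> \<star>\<^bsub>R\<^esub> a"
    and act_mono_right: "\<lbrakk>\<sigma> \<in> carrier A; a \<in> carrier R; b \<in> carrier R; a \<preceq>\<^bsub>R\<^esub> b\<rbrakk> \<Longrightarrow>
      \<sigma> \<star>\<^bsub>R\<^esub> a \<preceq>\<^bsub>R\<^esub> \<sigma> \<star>\<^bsub>R\<^esub> b"

definition module_morphism ::
  "'a po_ring \<Rightarrow> ('a, 'r) po_module \<Rightarrow> ('a, 's) po_module \<Rightarrow> ('r \<Rightarrow> 's) \<Rightarrow> bool" where
  "module_morphism A R S f \<longleftrightarrow>
     f \<in> carrier R \<rightarrow> carrier S \<and>
     (\<forall>a\<in>carrier R. \<forall>b\<in>carrier R. a \<preceq>\<^bsub>R\<^esub> b \<longrightarrow> f a \<preceq>\<^bsub>S\<^esub> f b) \<and>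
     (\<forall>a\<in>carrier R. \<forall>b\<in>carrier R. f (a \<oplus>\<^bsub>R\<^esub> b) = f a \<oplus>\<^bsub>S\<^esub> f b) \<and>
     f \<zero>\<^bsub>R\<^esub> = \<zero>\<^bsub>S\<^esub> \<and>
     (\<forall>\<sigma>\<in>carrier A. \<forall>a\<in>carrier R. f (\<sigma> \<star>\<^bsub>R\<^esub> a) = \<sigma> \<star>\<^bsub>S\<^esub> f a)"

definition cyclic_module :: "'a po_ring \<Rightarrow> ('a, 'r) po_module \<Rightarrow> bool" where
  "cyclic_module A R \<longleftrightarrow>
     po_module A R \<and> (\<exists>a\<in>carrier R. carrier R = {\<sigma> \<star>\<^bsub>R\<^esub> a | \<sigma>. \<sigma> \<in> carrier A})"

text \<open>
  The properties below quantify over all modules.  The types of the elements of these modules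
  are parameters; a theorem that leaves them as type variables covers all modules.
\<close>

definition onto_projective ::
  "'s itself \<Rightarrow> 't itself \<Rightarrow> 'a po_ring \<Rightarrow> ('a, 'r) po_module \<Rightarrow> bool" where
  "onto_projective s t A R \<longleftrightarrow>
     po_module A R \<and>
     (\<forall>(S :: ('a, 's) po_module) (T :: ('a, 't) po_module) f g.
        po_module A S \<longrightarrow> po_module A T \<longrightarrow>
        module_morphism A S T f \<longrightarrow> f ` carrier S = carrier T \<longrightarrow> module_morphism A R T g \<longrightarrow>
        (\<exists>h. module_morphism A R S h \<and> (\<forall>a\<in>carrier R. f (h a) = g a)))"

section \<open>Deductive operators and the representation property\<close>

definition deductive_operator :: "('r, 'm) po_ring_scheme \<Rightarrow> ('r \<Rightarrow> 'r set) \<Rightarrow> bool" where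
  "deductive_operator R \<delta> \<longleftrightarrow>
     \<delta> \<in> carrier R \<rightarrow> Pow (carrier R) \<and>
     (\<forall>a\<in>carrier R. a \<in> \<delta> a) \<and>
     (\<forall>a\<in>carrier R. \<forall>b\<in>carrier R. a \<preceq>\<^bsub>R\<^esub> b \<longrightarrow> \<delta> a \<subseteq> \<delta> b) \<and>
     (\<forall>a\<in>carrier R. \<forall>b\<in>carrier R. a \<in> \<delta> b \<longrightarrow> \<delta> a \<subseteq> \<delta> b) \<and>
     (\<forall>a\<in>carrier R. \<forall>b\<in>carrier R. \<forall>c\<in>carrier R. a \<in> \<delta> b \<longrightarrow> a \<oplus>\<^bsub>R\<^esub> c \<in> \<delta> (b \<oplus>\<^bsub>R\<^esub> c))"

definition action_invariant :: "'a po_ring \<Rightarrow> ('a, 'r) po_module \<Rightarrow> ('r \<Rightarrow> 'r set) \<Rightarrow> bool" where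
  "action_invariant A R \<delta> \<longleftrightarrow>
     (\<forall>\<sigma>\<in>carrier A. \<forall>a\<in>carrier R. \<forall>b\<in>carrier R. a \<in> \<delta> b \<longrightarrow> \<sigma> \<star>\<^bsub>R\<^esub> a \<in> \<delta> (\<sigma> \<star>\<^bsub>R\<^esub> b))"

text \<open>
  The module of theories of \<open>\<delta>\<close>.  The operations are defined on representatives; the lemmas
  \<open>theory_module_add\<close> and \<open>theory_module_act\<close> show that the choice of these is immaterial.
\<close>

definition theory_module :: "('a, 'r) po_module \<Rightarrow> ('r \<Rightarrow> 'r set) \<Rightarrow> ('a, 'r set) po_module" where
  "theory_module R \<delta> =
     (let rep = inv_into (carrier R) \<delta> in
      \<lparr>carrier = \<delta> ` carrier R,
       monoid.mult = undefined,
       one = undefined,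
       zero = \<delta> \<zero>\<^bsub>R\<^esub>,
       add = (\<lambda>X Y. \<delta> (rep X \<oplus>\<^bsub>R\<^esub> rep Y)),
       leq = (\<subseteq>),
       act = (\<lambda>\<sigma> X. \<delta> (\<sigma> \<star>\<^bsub>R\<^esub> rep X))\<rparr>)"

lemma deductive_operator_eqI:
  assumes "deductive_operator R \<delta>" "a \<in> carrier R" "b \<in> carrier R" "a \<in> \<delta> b" "b \<in> \<delta> a"
  shows "\<delta> a = \<delta> b"
  using assms unfolding deductive_operator_def by blast

lemma theory_module_add:
  assumes "comm_pomonoid R" and d: "deductive_operator R \<delta>"
    and a: "a \<in> carrier R" and b: "b \<in> carrier R"
  shows "\<delta> a \<oplus>\<^bsub>theory_module R \<delta>\<^esub> \<delta> b = \<delta> (a \<oplus>\<^bsub>R\<^esub> b)"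
proof -
  interpret comm_pomonoid R by fact
  let ?a = "inv_into (carrier R) \<delta> (\<delta> a)" and ?b = "inv_into (carrier R) \<delta> (\<delta> b)"
  have a': "?a \<in> carrier R" "\<delta> ?a = \<delta> a" and b': "?b \<in> carrier R" "\<delta> ?b = \<delta> b"
    using a b by (simp_all add: inv_into_into f_inv_into_f)
  have step: "\<delta> (x \<oplus>\<^bsub>R\<^esub> z) = \<delta> (y \<oplus>\<^bsub>R\<^esub> z)"
    if "x \<in> carrier R" "y \<in> carrier R" "z \<in> carrier R" "\<delta> x = \<delta> y" for x y z
  proof (rule deductive_operator_eqI[OF d])
    have "x \<in> \<delta> x" "y \<in> \<delta> y" using d that(1,2) unfolding deductive_operator_def by blast+
    then have "x \<in> \<delta> y" "y \<in> \<delta> x" using that(4) by simp_all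
    then show "x \<oplus>\<^bsub>R\<^esub> z \<in> \<delta> (y \<oplus>\<^bsub>R\<^esub> z)" "y \<oplus>\<^bsub>R\<^esub> z \<in> \<delta> (x \<oplus>\<^bsub>R\<^esub> z)"
      using d that(1-3) unfolding deductive_operator_def by blast+
  qed (use that in auto)
  have "\<delta> (?a \<oplus>\<^bsub>R\<^esub> ?b) = \<delta> (a \<oplus>\<^bsub>R\<^esub> ?b)" by (rule step) (fact a' b' a)+
  also have "\<dots> = \<delta> (a \<oplus>\<^bsub>R\<^esub> b)" using step[OF b'(1) b a b'(2)] a b b'(1) by (simp add: a_comm)
  finally show ?thesis by (simp add: theory_module_def Let_def)
qed

lemma theory_module_act:
  assumes "po_module A R" and d: "deductive_operator R \<delta>" and i: "action_invariant A R \<delta>"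
    and \<sigma>: "\<sigma> \<in> carrier A" and a: "a \<in> carrier R"
  shows "\<sigma> \<star>\<^bsub>theory_module R \<delta>\<^esub> \<delta> a = \<delta> (\<sigma> \<star>\<^bsub>R\<^esub> a)"
proof -
  interpret po_module A R by fact
  let ?a = "inv_into (carrier R) \<delta> (\<delta> a)"
  have a': "?a \<in> carrier R" "\<delta> ?a = \<delta> a"
    using a by (simp_all add: inv_into_into f_inv_into_f)
  have "?a \<in> \<delta> ?a" "a \<in> \<delta> a" using d a a'(1) unfolding deductive_operator_def by blast+
  then have "?a \<in> \<delta> a" "a \<in> \<delta> ?a" using a'(2) by simp_all
  then have "\<sigma> \<star>\<^bsub>R\<^esub> ?a \<in> \<delta> (\<sigma> \<star>\<^bsub>R\<^esub> a)" "\<sigma> \<star>\<^bsub>R\<^esub> a \<in> \<delta> (\<sigma> \<star>\<^bsub>R\<^esub> ?a)"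
    using i \<sigma> a a'(1) unfolding action_invariant_def by blast+
  then have "\<delta> (\<sigma> \<star>\<^bsub>R\<^esub> ?a) = \<delta> (\<sigma> \<star>\<^bsub>R\<^esub> a)"
    by (intro deductive_operator_eqI[OF d] act_closed \<sigma> a a'(1))
  then show ?thesis by (simp add: theory_module_def Let_def)
qed

definition representation_property :: "'s itself \<Rightarrow> 'a po_ring \<Rightarrow> ('a, 'r) po_module \<Rightarrow> bool" where
  "representation_property s A R \<longleftrightarrow>
     po_module A R \<and>
     (\<forall>(S :: ('a, 's) po_module) \<delta> \<gamma> \<Phi>.
        po_module A S \<longrightarrow>
        deductive_operator R \<delta> \<longrightarrow> action_invariant A R \<delta> \<longrightarrow>
        deductive_operator S \<gamma> \<longrightarrow> action_invariant A S \<gamma> \<longrightarrow>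
        module_morphism A (theory_module R \<delta>) (theory_module S \<gamma>) \<Phi> \<longrightarrow>
        inj_on \<Phi> (carrier (theory_module R \<delta>)) \<longrightarrow>
        (\<forall>X\<in>carrier (theory_module R \<delta>). \<forall>Y\<in>carrier (theory_module R \<delta>).
           \<Phi> X \<preceq>\<^bsub>theory_module S \<gamma>\<^esub> \<Phi> Y \<longrightarrow> X \<preceq>\<^bsub>theory_module R \<delta>\<^esub> Y) \<longrightarrow>
        (\<exists>\<tau>. module_morphism A R S \<tau> \<and> (\<forall>a\<in>carrier R. \<gamma> (\<tau> a) = \<Phi> (\<delta> a))))"


section \<open>Formulas, substitutions and multisets of formulas\<close>

record 'f language =
  connectives :: "'f set"
  arity :: "'f \<Rightarrow> nat"

datatype 'f fm = Var nat | Op 'f "'f fm list"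

inductive_set Fm :: "'f language \<Rightarrow> 'f fm set" for L where
  Var: "Var n \<in> Fm L"
| Op: "\<lbrakk>c \<in> connectives L; length \<phi>s = arity L c; \<forall>\<phi>\<in>set \<phi>s. \<phi> \<in> Fm L\<rbrakk> \<Longrightarrow> Op c \<phi>s \<in> Fm L"

text \<open>
  Substitutions are extensional functions, so that equality of functions is equality of
  endomorphisms of the formula algebra with universe \<open>Fm L\<close>.
\<close>

definition End :: "'f language \<Rightarrow> ('f fm \<Rightarrow> 'f fm) set" where
  "End L = {\<sigma> \<in> Fm L \<rightarrow>\<^sub>E Fm L. \<forall>c \<phi>s. Op c \<phi>s \<in> Fm L \<longrightarrow> \<sigma> (Op c \<phi>s) = Op c (map \<sigma> \<phi>s)}"

definition subst_semiring :: "'f language \<Rightarrow> ('f fm \<Rightarrow> 'f fm) multiset po_ring" where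
  "subst_semiring L =
     \<lparr>carrier = {X. set_mset X \<subseteq> End L},
      monoid.mult = (\<lambda>X Y. \<Sum>\<^sub># {#{#compose (Fm L) \<sigma> \<pi>. \<pi> \<in># Y#}. \<sigma> \<in># X#}),
      one = {#\<lambda>\<phi>\<in>Fm L. \<phi>#},
      zero = {#},
      add = (+),
      leq = (\<subseteq>#)\<rparr>"

definition Mult_module ::
  "'f language \<Rightarrow> (('f fm \<Rightarrow> 'f fm) multiset, 'f fm multiset) po_module" where
  "Mult_module L =
     \<lparr>carrier = {\<Gamma>. set_mset \<Gamma> \<subseteq> Fm L},
      monoid.mult = undefined,
      one = undefined,
      zero = {#},
      add = (+),
      leq = (\<subseteq>#),
      act = (\<lambda>X \<Gamma>. \<Sum>\<^sub># {#image_mset \<sigma> \<Gamma>. \<sigma> \<in># X#})\<rparr>"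

end

theory Submission
  imports Defs
begin

text \<open>
  Sending a formula \<open>\<phi>\<close> to the substitution \<open>\<sigma>\<^sub>\<phi>\<close> that maps every variable to \<open>\<phi>\<close> embeds the
  module of multisets of formulas into the semiring of multisets of substitutions, regarded as
  a module over itself: it commutes with the action because \<open>\<sigma> \<circ> \<sigma>\<^sub>\<phi>\<close> maps every variable to
  \<open>\<sigma> \<phi>\<close>.  It is split by \<open>X \<mapsto> X \<star> [x]\<close> for any variable \<open>x\<close>, so the module is a retract of the
  free module on one generator.  Hence morphisms out of it may be prescribed by a preimage of
  the value at \<open>[x]\<close>, which gives projectivity and the representation property.
\<close>

section \<open>Retracts of the semiring\<close>

text \<open>An abstract retract of the free module on one generator, with section \<open>c\<close>.
  The morphism laws of \<open>c\<close> are written out one by one, so that \<open>A\<close> need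
  not be rebuilt as a module record.\<close>

locale semiring_retract = po_module A R
  for A :: "'a po_ring" (structure) and R :: "('a, 'r) po_module" (structure) +
  fixes c :: "'r \<Rightarrow> 'a" and u :: 'r
  assumes section_closed: "a \<in> carrier R \<Longrightarrow> c a \<in> carrier A"
    and section_mono: "\<lbrakk>a \<in> carrier R; b \<in> carrier R; a \<preceq>\<^bsub>R\<^esub> b\<rbrakk> \<Longrightarrow> c a \<preceq>\<^bsub>A\<^esub> c b"
    and section_add: "\<lbrakk>a \<in> carrier R; b \<in> carrier R\<rbrakk> \<Longrightarrow> c (a \<oplus>\<^bsub>R\<^esub> b) = c a \<oplus>\<^bsub>A\<^esub> c b"
    and section_zero: "c \<zero>\<^bsub>R\<^esub> = \<zero>\<^bsub>A\<^esub>"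
    and section_act: "\<lbrakk>\<sigma> \<in> carrier A; a \<in> carrier R\<rbrakk> \<Longrightarrow> c (\<sigma> \<star>\<^bsub>R\<^esub> a) = \<sigma> \<otimes>\<^bsub>A\<^esub> c a"
    and generator_closed: "u \<in> carrier R"
    and section_generator: "a \<in> carrier R \<Longrightarrow> c a \<star>\<^bsub>R\<^esub> u = a"
begin

lemma cyclic: "cyclic_module A R"
  unfolding cyclic_module_def
proof (intro conjI bexI)
  show "carrier R = {\<sigma> \<star>\<^bsub>R\<^esub> u |\<sigma>. \<sigma> \<in> carrier A}"
    using section_generator section_closed act_closed generator_closed
    by (auto intro: exI[of _ "c _"]) metis
qed (fact po_module_axioms generator_closed)+

text \<open>This is \<open>c\<close> followed by the orbit map of \<open>s\<close>, the morphism out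
  of the free module that sends its generator to \<open>s\<close>.\<close>

lemma morphism_section_act:
  assumes "po_module A S" and s: "s \<in> carrier S"
  shows "module_morphism A R S (\<lambda>a. c a \<star>\<^bsub>S\<^esub> s)"
proof -
  interpret S: po_module A S by fact
  show ?thesis
    unfolding module_morphism_def
    using s by (auto simp: section_closed section_mono section_add section_zero section_act
        S.act_closed S.act_mono_left S.act_add_left S.act_zero S.act_mult)
qed

lemma onto_projective: "onto_projective TYPE('s) TYPE('t) A R"
  unfolding onto_projective_def
proof (intro conjI allI impI)
  fix S :: "('a, 's) po_module" and T :: "('a, 't) po_module" and f g
  assume S: "po_module A S" and f: "module_morphism A S T f" "f ` carrier S = carrier T"
    and g: "module_morphism A R T g"
  have "g u \<in> carrier T"
    using g generator_closed by (auto simp: module_morphism_def)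
  \<comment> \<open>Surjectivity is applied to one element only. Since every \<open>a\<close> equals
    \<open>c a \<star> u\<close>, lifting \<open>g u\<close> determines a lift of all of
    \<open>g\<close>.\<close>
  then obtain s where s: "s \<in> carrier S" "f s = g u"
    using f(2) by (metis imageE)
  have "f (c a \<star>\<^bsub>S\<^esub> s) = g a" if a: "a \<in> carrier R" for a
  proof -
    have "f (c a \<star>\<^bsub>S\<^esub> s) = c a \<star>\<^bsub>T\<^esub> g u"
      using f(1) s section_closed[OF a] by (simp add: module_morphism_def)
    also have "\<dots> = g (c a \<star>\<^bsub>R\<^esub> u)"
      using g generator_closed section_closed[OF a] by (simp add: module_morphism_def)
    finally show ?thesis
      by (simp add: section_generator a)
  qed
  with morphism_section_act[OF S s(1)]
  show "\<exists>h. module_morphism A R S h \<and> (\<forall>a\<in>carrier R. f (h a) = g a)"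
    by blast
qed (fact po_module_axioms)

text \<open>The lifting argument again, with \<gamma> as the surjection: it maps \<open>S\<close>
  onto its theory module and commutes with the action by \<open>theory_module_act\<close>.\<close>

lemma representation_property: "representation_property TYPE('s) A R"
  unfolding representation_property_def
proof (intro conjI allI impI)
  fix S :: "('a, 's) po_module" and \<delta> \<gamma> \<Phi>
  assume S: "po_module A S"
    and \<delta>: "deductive_operator R \<delta>" "action_invariant A R \<delta>"
    and \<gamma>: "deductive_operator S \<gamma>" "action_invariant A S \<gamma>"
    and \<Phi>: "module_morphism A (theory_module R \<delta>) (theory_module S \<gamma>) \<Phi>"
  have carrier: "carrier (theory_module R \<delta>) = \<delta> ` carrier R"
    "carrier (theory_module S \<gamma>) = \<gamma> ` carrier S"
    by (simp_all add: theory_module_def Let_def)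
  have "\<Phi> (\<delta> u) \<in> \<gamma> ` carrier S"
    using \<Phi> generator_closed by (auto simp: module_morphism_def carrier)
  then obtain s where s: "s \<in> carrier S" "\<gamma> s = \<Phi> (\<delta> u)"
    by (metis imageE)
  have "\<gamma> (c a \<star>\<^bsub>S\<^esub> s) = \<Phi> (\<delta> a)" if a: "a \<in> carrier R" for a
  proof -
    have "\<gamma> (c a \<star>\<^bsub>S\<^esub> s) = c a \<star>\<^bsub>theory_module S \<gamma>\<^esub> \<Phi> (\<delta> u)"
      using theory_module_act[OF S \<gamma> section_closed[OF a] s(1)] s(2) by simp
    also have "\<dots> = \<Phi> (c a \<star>\<^bsub>theory_module R \<delta>\<^esub> \<delta> u)"
      using \<Phi> generator_closed section_closed[OF a] by (simp add: module_morphism_def carrier)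
    also have "\<dots> = \<Phi> (\<delta> (c a \<star>\<^bsub>R\<^esub> u))"
      using theory_module_act[OF po_module_axioms \<delta> section_closed[OF a] generator_closed] by simp
    finally show ?thesis
      by (simp add: section_generator a)
  qed
  with morphism_section_act[OF S s(1)]
  show "\<exists>\<tau>. module_morphism A R S \<tau> \<and> (\<forall>a\<in>carrier R. \<gamma> (\<tau> a) = \<Phi> (\<delta> a))"
    by blast
qed (fact po_module_axioms)

end

section \<open>Substitutions\<close>

lemma Op_in_Fm_iff:
  "Op c \<phi>s \<in> Fm L \<longleftrightarrow> c \<in> connectives L \<and> length \<phi>s = arity L c \<and> set \<phi>s \<subseteq> Fm L"
  by (auto intro: Fm.Op elim: Fm.cases)

lemma End_closed: "\<lbrakk>\<sigma> \<in> End L; \<phi> \<in> Fm L\<rbrakk> \<Longrightarrow> \<sigma> \<phi> \<in> Fm L"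
  by (auto simp: End_def)

lemma End_Op: "\<lbrakk>\<sigma> \<in> End L; Op c \<phi>s \<in> Fm L\<rbrakk> \<Longrightarrow> \<sigma> (Op c \<phi>s) = Op c (map \<sigma> \<phi>s)"
  by (simp add: End_def)

lemma End_extensional: "\<sigma> \<in> End L \<Longrightarrow> \<sigma> \<in> extensional (Fm L)"
  by (auto simp: End_def PiE_def)

text \<open>Induction on formulas gives agreement on \<open>Fm L\<close>; extensionality gives it
  everywhere else.\<close>

lemma End_eqI:
  assumes \<sigma>: "\<sigma> \<in> End L" and \<pi>: "\<pi> \<in> End L" and "\<And>n. \<sigma> (Var n) = \<pi> (Var n)"
  shows "\<sigma> = \<pi>"
proof (rule extensionalityI[OF End_extensional[OF \<sigma>] End_extensional[OF \<pi>]])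
  fix \<phi> assume "\<phi> \<in> Fm L"
  then show "\<sigma> \<phi> = \<pi> \<phi>"
  proof induction
    case (Op c \<phi>s)
    then have "Op c \<phi>s \<in> Fm L" by (auto simp: Op_in_Fm_iff)
    with Op show ?case by (simp add: End_Op[OF \<sigma>] End_Op[OF \<pi>])
  qed (fact assms(3))
qed

lemma id_in_End: "(\<lambda>\<phi>\<in>Fm L. \<phi>) \<in> End L"
  by (auto simp: End_def Op_in_Fm_iff subset_iff intro!: map_idI[symmetric])

lemma compose_in_End:
  assumes "\<sigma> \<in> End L" "\<pi> \<in> End L"
  shows "compose (Fm L) \<sigma> \<pi> \<in> End L"
proof -
  have "compose (Fm L) \<sigma> \<pi> (Op c \<phi>s) = Op c (map (compose (Fm L) \<sigma> \<pi>) \<phi>s)"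
    if \<phi>: "Op c \<phi>s \<in> Fm L" for c \<phi>s
  proof -
    \<comment> \<open>The homomorphism law of \<sigma> is available only at formulas of the
      language, so the image under \<pi> has to be one.\<close>
    have "Op c (map \<pi> \<phi>s) \<in> Fm L"
      using End_closed[OF assms(2) \<phi>] End_Op[OF assms(2) \<phi>] by simp
    then show ?thesis
      using \<phi> assms by (auto simp: compose_eq End_Op Op_in_Fm_iff subset_iff)
  qed
  then show ?thesis
    using assms by (auto simp: End_def compose_eq) (auto simp: compose_def)
qed

text \<open>All variables receive the same value, because composing with \<sigma> on the left then
  yields a substitution of the same kind. Were the other variables left fixed, the composite would
  send them to their images under \<sigma>.\<close>

primrec const_subst :: "'f fm \<Rightarrow> 'f fm \<Rightarrow> 'f fm" where
  "const_subst \<phi> (Var n) = \<phi>"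
| "const_subst \<phi> (Op c \<psi>s) = Op c (map (const_subst \<phi>) \<psi>s)"

definition const_End :: "'f language \<Rightarrow> 'f fm \<Rightarrow> 'f fm \<Rightarrow> 'f fm" where
  "const_End L \<phi> = restrict (const_subst \<phi>) (Fm L)"

lemma const_End_Var: "const_End L \<phi> (Var n) = \<phi>"
  by (simp add: const_End_def Fm.Var)

lemma const_End_in_End:
  assumes "\<phi> \<in> Fm L"
  shows "const_End L \<phi> \<in> End L"
proof -
  have "const_subst \<phi> \<psi> \<in> Fm L" if "\<psi> \<in> Fm L" for \<psi>
    using that by induction (auto simp: assms Op_in_Fm_iff)
  then show ?thesis
    by (auto simp: End_def const_End_def Op_in_Fm_iff subset_iff)
qed

text \<open>Both sides are endomorphisms with value \<open>\<sigma> \<phi>\<close> at every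
  variable.\<close>

lemma compose_const_End:
  assumes "\<sigma> \<in> End L" "\<phi> \<in> Fm L"
  shows "compose (Fm L) \<sigma> (const_End L \<phi>) = const_End L (\<sigma> \<phi>)"
  using assms
  by (intro End_eqI[of _ L])
    (auto simp: compose_in_End const_End_in_End End_closed const_End_Var compose_eq Fm.Var)

section \<open>Multisets of formulas as a retract\<close>

text \<open>The two distributive laws hold for arbitrary multisets. They reduce associativity to a
  singleton left factor and also yield monotonicity.\<close>

lemma dually_integral_po_semiring_subst_semiring:
  "dually_integral_po_semiring (subst_semiring L)" (is "dually_integral_po_semiring ?A")
proof -
  let ?mult = "monoid.mult ?A"
  have l_distr: "?mult (X + Y) Z = ?mult X Z + ?mult Y Z" for X Y Z
    by (simp add: subst_semiring_def)
  have r_distr: "?mult Z (X + Y) = ?mult Z X + ?mult Z Y" for X Y Z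
    by (simp add: subst_semiring_def sum_mset.distrib)
  have closed: "?mult X Y \<in> carrier ?A" if "X \<in> carrier ?A" "Y \<in> carrier ?A" for X Y
    using that by (auto simp: subst_semiring_def subset_iff compose_in_End)
  \<comment> \<open>Multiplying on the left by the singleton of \<sigma> is
    \<open>image_mset (compose (Fm L) \<sigma>)\<close>.\<close>
  have single_assoc: "?mult (image_mset (compose (Fm L) \<sigma>) Y) Z =
      image_mset (compose (Fm L) \<sigma>) (?mult Y Z)"
    if "\<sigma> \<in> End L" "Y \<in> carrier ?A" "Z \<in> carrier ?A" for \<sigma> Y Z
    using that(2)
  proof (induction Y)
    case (add \<pi> Y)
    have "compose (Fm L) (compose (Fm L) \<sigma> \<pi>) \<rho> = compose (Fm L) \<sigma> (compose (Fm L) \<pi> \<rho>)"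
      if "\<rho> \<in># Z" for \<rho>
      using that \<open>Z \<in> carrier ?A\<close>
      by (subst compose_assoc[of _ _ "Fm L"]) (auto simp: subst_semiring_def End_def)
    then have "image_mset (compose (Fm L) (compose (Fm L) \<sigma> \<pi>)) Z =
        image_mset (compose (Fm L) \<sigma>) (image_mset (compose (Fm L) \<pi>) Z)"
      unfolding multiset.map_comp o_def by (rule image_mset_cong)
    with add show ?case
      by (simp add: subst_semiring_def)
  qed (simp add: subst_semiring_def)
  have assoc: "?mult (?mult X Y) Z = ?mult X (?mult Y Z)"
    if "X \<in> carrier ?A" "Y \<in> carrier ?A" "Z \<in> carrier ?A" for X Y Z
    using that(1)
  proof (induction X)
    case (add \<sigma> X)
    then have "\<sigma> \<in> End L" "X \<in> carrier ?A" by (auto simp: subst_semiring_def)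
    moreover have "?mult (add_mset \<sigma> X) W = image_mset (compose (Fm L) \<sigma>) W + ?mult X W" for W
      by (simp add: subst_semiring_def)
    ultimately show ?case
      using add.IH that by (simp add: l_distr single_assoc)
  qed (simp add: subst_semiring_def)
  \<comment> \<open>Composition with the restricted identity gives back \<sigma> itself, and not
    just its values on formulas, because \<sigma> is extensional.\<close>
  have id_compose: "compose (Fm L) (\<lambda>\<phi>\<in>Fm L. \<phi>) \<sigma> = \<sigma>" "compose (Fm L) \<sigma> (\<lambda>\<phi>\<in>Fm L. \<phi>) = \<sigma>"
    if "\<sigma> \<in> End L" for \<sigma>
    using that by (auto intro!: Id_compose compose_Id simp: End_def PiE_def)
  have l_one: "?mult \<one>\<^bsub>?A\<^esub> X = X" and r_one: "?mult X \<one>\<^bsub>?A\<^esub> = X" if "X \<in> carrier ?A" for X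
    using that by (induction X) (auto simp: subst_semiring_def id_compose)
  \<comment> \<open>An inclusion provides a complement \<open>W\<close> with
    \<open>Y = X + W\<close>, and distributivity splits off the product with
    \<open>W\<close>.\<close>
  have mono: "?mult X Z \<subseteq># ?mult Y Z" "?mult Z X \<subseteq># ?mult Z Y" if "X \<subseteq># Y" for X Y Z
    using that by (auto simp: mset_subset_eq_exists_conv l_distr r_distr)
  show ?thesis
    using closed l_distr r_distr assoc l_one r_one mono
    by unfold_locales (auto simp: subst_semiring_def id_in_End Units_def)
qed

lemma po_module_Mult_module: "po_module (subst_semiring L) (Mult_module L)"
    (is "po_module ?A ?R")
proof -
  interpret A: dually_integral_po_semiring ?A
    by (fact dually_integral_po_semiring_subst_semiring)
  let ?act = "act ?R"
  have add_left: "?act (X + Y) \<Gamma> = ?act X \<Gamma> + ?act Y \<Gamma>" for X Y \<Gamma>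
    by (simp add: Mult_module_def)
  have add_right: "?act X (\<Gamma> + \<Delta>) = ?act X \<Gamma> + ?act X \<Delta>" for X \<Gamma> \<Delta>
    by (simp add: Mult_module_def sum_mset.distrib)
  have closed: "?act X \<Gamma> \<in> carrier ?R" if "X \<in> carrier ?A" "\<Gamma> \<in> carrier ?R" for X \<Gamma>
    using that by (auto simp: subst_semiring_def Mult_module_def subset_iff End_closed)
  \<comment> \<open>The action law for a singleton. Restricted composition agrees with ordinary
    composition only on \<open>Fm L\<close>, hence the condition on \<Gamma>.\<close>
  have single_mult: "?act (image_mset (compose (Fm L) \<sigma>) Y) \<Gamma> = image_mset \<sigma> (?act Y \<Gamma>)"
    if "\<Gamma> \<in> carrier ?R" for \<sigma> Y \<Gamma>
  proof (induction Y)
    case (add \<pi> Y)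
    have "image_mset (compose (Fm L) \<sigma> \<pi>) \<Gamma> = image_mset \<sigma> (image_mset \<pi> \<Gamma>)"
      using that
      by (auto simp: Mult_module_def multiset.map_comp compose_eq intro!: image_mset_cong)
    with add show ?case by (simp add: Mult_module_def)
  qed (simp add: Mult_module_def)
  have mult: "?act (X \<otimes>\<^bsub>?A\<^esub> Y) \<Gamma> = ?act X (?act Y \<Gamma>)" if "\<Gamma> \<in> carrier ?R" for X Y \<Gamma>
  proof (induction X)
    case (add \<sigma> X)
    have "add_mset \<sigma> X \<otimes>\<^bsub>?A\<^esub> Y = image_mset (compose (Fm L) \<sigma>) Y + X \<otimes>\<^bsub>?A\<^esub> Y"
      by (simp add: subst_semiring_def)
    with add have "?act (add_mset \<sigma> X \<otimes>\<^bsub>?A\<^esub> Y) \<Gamma> = image_mset \<sigma> (?act Y \<Gamma>) + ?act X (?act Y \<Gamma>)"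
      by (simp add: add_left single_mult that)
    then show ?case by (simp add: Mult_module_def)
  qed (simp add: subst_semiring_def Mult_module_def)
  have one: "?act \<one>\<^bsub>?A\<^esub> \<Gamma> = \<Gamma>" if "\<Gamma> \<in> carrier ?R" for \<Gamma>
  proof -
    have "image_mset (\<lambda>\<phi>\<in>Fm L. \<phi>) \<Gamma> = image_mset id \<Gamma>"
      using that by (intro image_mset_cong) (auto simp: Mult_module_def)
    then show ?thesis by (simp add: subst_semiring_def Mult_module_def)
  qed
  have mono: "?act X \<Gamma> \<subseteq># ?act Y \<Gamma>" if "X \<subseteq># Y" for X Y \<Gamma>
    using that by (auto simp: mset_subset_eq_exists_conv add_left)
  have mono': "?act X \<Gamma> \<subseteq># ?act X \<Delta>" if "\<Gamma> \<subseteq># \<Delta>" for X \<Gamma> \<Delta>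
    using that by (auto simp: mset_subset_eq_exists_conv add_right)
  have ops: "(\<oplus>\<^bsub>?A\<^esub>) = (+)" "leq ?A = (\<subseteq>#)" "(\<oplus>\<^bsub>?R\<^esub>) = (+)" "leq ?R = (\<subseteq>#)"
    by (simp_all add: subst_semiring_def Mult_module_def)
  \<comment> \<open>With both additive structures interpreted, only the laws of the action remain
    for \<open>unfold_locales\<close>.\<close>
  have "comm_pomonoid ?R"
    by unfold_locales (auto simp: Mult_module_def Units_def)
  then interpret R: comm_pomonoid ?R .
  show ?thesis
    using closed add_left add_right mult one mono mono'
    by unfold_locales (simp_all add: ops, simp_all add: subst_semiring_def Mult_module_def)
qed

text \<open>The section commutes with the action: for a single \<sigma> this is
  \<open>compose_const_End\<close> applied to each member of \<Gamma>, and both sides are additive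
  in \<open>X\<close>.\<close>

lemma const_End_act:
  assumes "X \<in> carrier (subst_semiring L)" "\<Gamma> \<in> carrier (Mult_module L)"
  shows "image_mset (const_End L) (X \<star>\<^bsub>Mult_module L\<^esub> \<Gamma>) =
    X \<otimes>\<^bsub>subst_semiring L\<^esub> image_mset (const_End L) \<Gamma>"
  using assms(1)
proof (induction X)
  case (add \<sigma> X)
  have "image_mset (const_End L) (image_mset \<sigma> \<Gamma>) =
      image_mset (compose (Fm L) \<sigma>) (image_mset (const_End L) \<Gamma>)"
    unfolding multiset.map_comp o_def
    using add.prems assms(2)
    by (intro image_mset_cong) (auto simp: subst_semiring_def Mult_module_def compose_const_End)
  with add show ?case
    by (simp add: subst_semiring_def Mult_module_def)
qed (simp add: subst_semiring_def Mult_module_def)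

text \<open>Any variable could serve as generator, since \<open>const_End L \<phi>\<close> takes the
  value \<phi> at each of them.\<close>

lemma semiring_retract_Mult_module:
  "semiring_retract (subst_semiring L) (Mult_module L) (image_mset (const_End L)) {#Var 0#}"
proof -
  interpret po_module "subst_semiring L" "Mult_module L"
    by (fact po_module_Mult_module)
  show ?thesis
  proof
    show "image_mset (const_End L) \<Gamma> \<star>\<^bsub>Mult_module L\<^esub> {#Var 0#} = \<Gamma>" for \<Gamma>
      by (induction \<Gamma>) (simp_all add: Mult_module_def const_End_Var)
  qed (use const_End_act in \<open>auto simp: subst_semiring_def Mult_module_def const_End_in_End Fm.Var
      image_mset_subseteq_mono\<close>)
qed

theorem theorem4p18:
  fixes L :: "'f language"
  shows "cyclic_module (subst_semiring L) (Mult_module L) \<and>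
         onto_projective TYPE('s) TYPE('t) (subst_semiring L) (Mult_module L) \<and>
         representation_property TYPE('u) (subst_semiring L) (Mult_module L)"
proof -
  interpret semiring_retract "subst_semiring L" "Mult_module L" "image_mset (const_End L)" "{#Var 0#}"
    by (fact semiring_retract_Mult_module)
  show ?thesis
    using cyclic onto_projective representation_property by blast
qed

end
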